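(* There exists a dense subset $X$ of $\mathbb{R}$ with $X\neq\mathbb{R}$ such that every autohomeomorphism $f$ of the space $E(X)$ is norm-preserving, that is, $\|f(x)\|=\|x\|$ for all $x\in E(X)$, and such that $E(X)$ is not homogeneous.
   Context: $\ell_2=\{x\in\mathbb{R}^{\omega}:\sum_{i\in\omega}x_i^2<\infty\}$ is real separable Hilbert space with norm $\|x\|=\bigl(\sum_{i\in\omega}x_i^2\bigr)^{1/2}$ and the topology induced by this norm. For a subset $X\subseteq\mathbb{R}$ put $E(X)=\{x\in\ell_2:(\forall i\in\omega)(x_i\in X)\}$, with the subspace topology inherited from the norm topology of $\ell_2$. An autohomeomorphism of a space is a homeomorphism of the space onto itself. A space is homogeneous if for any two of its points there is an autohomeomorphism of the space mapping the first to the second. *)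

theory Defs
  imports "HOL-Analysis.Analysis"
begin

typedef ell2 = "{x :: nat \<Rightarrow> real. summable (\<lambda>i. (x i)\<^sup>2)}"
  morphisms coord Abs_ell2
  by (rule exI[of _ "\<lambda>_. 0"]) simp

setup_lifting type_definition_ell2

lemma summable_coord_sq: "summable (\<lambda>i. (coord x i)\<^sup>2)"
  using coord[of x] by simp

lemma summable_sq_mult:
  fixes x y :: "nat \<Rightarrow> real"
  assumes "summable (\<lambda>i. (x i)\<^sup>2)" and "summable (\<lambda>i. (y i)\<^sup>2)"
  shows "summable (\<lambda>i. x i * y i)"
proof (rule summable_comparison_test'[OF summable_add[OF assms]])
  fix i :: nat
  have "2 * (\<bar>x i\<bar> * \<bar>y i\<bar>) \<le> (x i)\<^sup>2 + (y i)\<^sup>2"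
    using sum_squares_bound[of "\<bar>x i\<bar>" "\<bar>y i\<bar>"] by simp
  moreover have "0 \<le> \<bar>x i\<bar> * \<bar>y i\<bar>" by simp
  ultimately show "norm (x i * y i) \<le> (x i)\<^sup>2 + (y i)\<^sup>2"
    unfolding real_norm_def abs_mult by linarith
qed

lemma summable_sq_add:
  fixes x y :: "nat \<Rightarrow> real"
  assumes "summable (\<lambda>i. (x i)\<^sup>2)" and "summable (\<lambda>i. (y i)\<^sup>2)"
  shows "summable (\<lambda>i. (x i + y i)\<^sup>2)"
proof -
  have "summable (\<lambda>i. (x i)\<^sup>2 + (y i)\<^sup>2 + 2 * (x i * y i))"
    by (intro summable_add summable_mult summable_sq_mult assms)
  then show ?thesis by (simp add: power2_sum mult.assoc)
qed

lemma summable_sq_scale: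
  fixes x :: "nat \<Rightarrow> real"
  assumes "summable (\<lambda>i. (x i)\<^sup>2)"
  shows "summable (\<lambda>i. (r * x i)\<^sup>2)"
  using summable_mult[OF assms, of "r\<^sup>2"] by (simp add: power_mult_distrib)

lemma summable_sq_diff:
  fixes x y :: "nat \<Rightarrow> real"
  assumes "summable (\<lambda>i. (x i)\<^sup>2)" and "summable (\<lambda>i. (y i)\<^sup>2)"
  shows "summable (\<lambda>i. (x i - y i)\<^sup>2)"
  using summable_sq_add[OF assms(1) summable_sq_scale[OF assms(2), of "-1"]] by simp

text \<open>
  The topology on \<^typ>\<open>ell2\<close> is the one induced by \<open>dist x y = norm (x - y)\<close>,
  not the topology of coordinatewise convergence.
\<close>

instantiation ell2 :: real_inner
begin

lift_definition zero_ell2 :: ell2 is "\<lambda>_. 0" by simp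

lift_definition plus_ell2 :: "ell2 \<Rightarrow> ell2 \<Rightarrow> ell2" is "\<lambda>x y i. x i + y i"
  by (rule summable_sq_add)

lift_definition minus_ell2 :: "ell2 \<Rightarrow> ell2 \<Rightarrow> ell2" is "\<lambda>x y i. x i - y i"
  by (rule summable_sq_diff)

lift_definition uminus_ell2 :: "ell2 \<Rightarrow> ell2" is "\<lambda>x i. - x i" by simp

lift_definition scaleR_ell2 :: "real \<Rightarrow> ell2 \<Rightarrow> ell2" is "\<lambda>r x i. r * x i"
  by (rule summable_sq_scale)

lift_definition inner_ell2 :: "ell2 \<Rightarrow> ell2 \<Rightarrow> real" is "\<lambda>x y. \<Sum>i. x i * y i" .

lift_definition norm_ell2 :: "ell2 \<Rightarrow> real" is "\<lambda>x. sqrt (\<Sum>i. (x i)\<^sup>2)" .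

definition sgn_ell2 :: "ell2 \<Rightarrow> ell2" where "sgn_ell2 x = inverse (norm x) *\<^sub>R x"

definition dist_ell2 :: "ell2 \<Rightarrow> ell2 \<Rightarrow> real" where "dist_ell2 x y = norm (x - y)"

definition uniformity_ell2 :: "(ell2 \<times> ell2) filter" where
  "uniformity_ell2 = (INF e\<in>{0<..}. principal {(x, y). dist x y < e})"

definition open_ell2 :: "ell2 set \<Rightarrow> bool" where
  "open_ell2 U \<longleftrightarrow> (\<forall>x\<in>U. eventually (\<lambda>(x', y). x' = x \<longrightarrow> y \<in> U) uniformity)"

instance
proof
  fix x y z :: ell2 and r s :: real
  show "x + y + z = x + (y + z)" by transfer (simp add: add.assoc)
  show "x + y = y + x" by transfer (simp add: add.commute)
  show "0 + x = x" by transfer simp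
  show "- x + x = 0" by transfer simp
  show "x - y = x + - y" by transfer simp
  show "r *\<^sub>R (x + y) = r *\<^sub>R x + r *\<^sub>R y" by transfer (simp add: algebra_simps)
  show "(r + s) *\<^sub>R x = r *\<^sub>R x + s *\<^sub>R x" by transfer (simp add: algebra_simps)
  show "r *\<^sub>R s *\<^sub>R x = (r * s) *\<^sub>R x" by transfer (simp add: mult.assoc)
  show "1 *\<^sub>R x = x" by transfer simp
  show "sgn x = inverse (norm x) *\<^sub>R x" by (rule sgn_ell2_def)
  show "dist x y = norm (x - y)" by (rule dist_ell2_def)
  show "(uniformity :: (ell2 \<times> ell2) filter) = (INF e\<in>{0<..}. principal {(x, y). dist x y < e})"
    by (rule uniformity_ell2_def)
  show "open U \<longleftrightarrow> (\<forall>x\<in>U. eventually (\<lambda>(x', y). x' = x \<longrightarrow> y \<in> U) uniformity)" for U :: "ell2 set"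
    by (rule open_ell2_def)
  show "inner x y = inner y x" by transfer (simp add: mult.commute)
  show "inner (x + y) z = inner x z + inner y z"
    by transfer (simp add: distrib_right suminf_add summable_sq_mult)
  show "inner (r *\<^sub>R x) y = r * inner x y"
    by transfer (simp add: mult.assoc suminf_mult summable_sq_mult)
  show "0 \<le> inner x x"
    by transfer (simp add: suminf_nonneg flip: power2_eq_square)
  show "inner x x = 0 \<longleftrightarrow> x = 0"
    by transfer (simp add: suminf_eq_zero_iff fun_eq_iff flip: power2_eq_square)
  show "norm x = sqrt (inner x x)"
    by transfer (simp add: power2_eq_square)
qed

end

definition E :: "real set \<Rightarrow> ell2 set" where
  "E X = {x. \<forall>i. coord x i \<in> X}"

text \<open>
  As in \<^const>\<open>homeomorphism\<close>, a space is a subset with its subspace topology;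
  \<open>f\<close> is a total function, and only its values on \<open>S\<close> matter.
\<close>

definition autohomeomorphism :: "'a::topological_space set \<Rightarrow> ('a \<Rightarrow> 'a) \<Rightarrow> bool" where
  "autohomeomorphism S f \<longleftrightarrow> (\<exists>g. homeomorphism S S f g)"

definition homogeneous :: "'a::topological_space set \<Rightarrow> bool" where
  "homogeneous S \<longleftrightarrow> (\<forall>x\<in>S. \<forall>y\<in>S. \<exists>f. autohomeomorphism S f \<and> f x = y)"

end

theory Submission
  imports Defs
begin

text \<open>
  Suppose \<open>f\<close> is an autohomeomorphism of \<open>E X\<close>, \<open>X\<close> dense. If, on a dense family of open sets,
  each coordinate of \<open>f x\<close> is one of the coordinates of \<open>x\<close>, and likewise for the inverse of \<open>f\<close>,
  then Baire category yields, arbitrarily near any point of the graph, a point \<open>(x, y)\<close> of its closure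
  in which \<open>x\<close> and \<open>y\<close> have distinct coordinates and the same set of coordinates. There
  \<open>\<parallel>x\<parallel> = \<parallel>y\<parallel>\<close>, hence \<open>f\<close> preserves the norm.

  Otherwise some coordinate \<open>i\<close> of \<open>f x\<close> (or of the inverse) differs from all coordinates of \<open>x\<close>
  generically in an open set, and a Cantor scheme gives continuum many points \<open>(x, y)\<close> of the
  Lavrentiev-type extension of \<open>f\<close> with \<open>y i \<notin> {x j | j}\<close>, such that every real number is a coordinate
  of \<open>x\<close>, or equal to \<open>y i\<close>, for only countably many of them. The extension is determined by a
  countable dense part of the graph, so there are only continuum many extensions. A transfinite recursion
  of that length builds \<open>X\<close> so as to contain all coordinates of such an \<open>x\<close> but not \<open>y i\<close>;
  then \<open>f x = y\<close> is not in \<open>E X\<close>.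
\<close>

unbundle cardinal_syntax

subsection \<open>The space \<open>ell2\<close>\<close>

lift_definition ell2_unit :: "nat \<Rightarrow> ell2" is "\<lambda>n i. if i = n then 1 else 0"
proof -
  fix n :: nat
  have "(\<lambda>i. (if i = n then 1 else 0 :: real)\<^sup>2) = (\<lambda>i. if i = n then 1 else 0)"
    by auto
  then show "summable (\<lambda>i. (if i = n then 1 else 0 :: real)\<^sup>2)"
    by simp
qed

lemma coord_unit: "coord (ell2_unit n) i = (if i = n then 1 else 0)"
  by (simp add: ell2_unit.rep_eq)

text \<open>Through the inner product, coordinates inherit continuity and the Cauchy-Schwarz bound
  by the norm.\<close>

lemma inner_unit: "inner x (ell2_unit n) = coord x n"
proof -
  have "(\<lambda>i. coord x i * (if i = n then 1 else 0)) = (\<lambda>i. if i = n then coord x n else 0)"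
    by auto
  moreover have "(\<lambda>i. if i = n then coord x n else 0) sums coord x n"
    using sums_single[of n "\<lambda>_. coord x n"] by simp
  ultimately show ?thesis
    by (simp add: inner_ell2.rep_eq coord_unit sums_iff)
qed

lemma continuous_on_coord: 
  assumes "continuous_on S f"
  shows "continuous_on S (\<lambda>z. coord (f z) i)"
  using assms by (auto simp flip: inner_unit intro!: continuous_intros)

lemma norm_unit: "norm (ell2_unit n) = 1"
  by (simp add: norm_eq_sqrt_inner inner_unit coord_unit)

lemma ell2_eqI: "(\<And>i. coord x i = coord y i) \<Longrightarrow> x = y"
  by (metis coord_inject ext)

lemma coord_simps [simp]:
  "coord 0 i = 0" "coord (x + y) i = coord x i + coord y i"
  "coord (x - y) i = coord x i - coord y i" "coord (r *\<^sub>R x) i = r * coord x i"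
  by (simp_all add: zero_ell2.rep_eq plus_ell2.rep_eq minus_ell2.rep_eq scaleR_ell2.rep_eq)

lemma norm_ell2_sq: "(norm x)\<^sup>2 = (\<Sum>i. (coord x i)\<^sup>2)"
  by (simp add: norm_ell2.rep_eq suminf_nonneg summable_coord_sq)

lemma abs_coord_le_norm: "\<bar>coord x i\<bar> \<le> norm x"
  using Cauchy_Schwarz_ineq2[of x "ell2_unit i"]
  by (simp add: inner_unit norm_unit)

lemma sum_coord_sq_le: "(\<Sum>i<N. (coord x i)\<^sup>2) \<le> (norm x)\<^sup>2"
  unfolding norm_ell2_sq by (rule sum_le_suminf) (auto simp: summable_coord_sq)

text \<open>The limit is taken coordinatewise. Completeness is what makes the branches of the Cantor
  schemes converge.\<close>

instance ell2 :: complete_space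
proof
  fix X :: "nat \<Rightarrow> ell2"
  assume "Cauchy X"
  have "Cauchy (\<lambda>n. coord (X n) i)" for i
    unfolding Cauchy_def
  proof (intro allI impI)
    fix e :: real
    assume "e > 0"
    then obtain M where "\<And>m n. m \<ge> M \<Longrightarrow> n \<ge> M \<Longrightarrow> norm (X m - X n) < e"
      using \<open>Cauchy X\<close> unfolding Cauchy_def dist_norm by blast
    then have "dist (coord (X m) i) (coord (X n) i) < e" if "m \<ge> M" "n \<ge> M" for m n
      using abs_coord_le_norm[of "X m - X n" i] that by (force simp: dist_real_def)
    then show "\<exists>M. \<forall>m\<ge>M. \<forall>n\<ge>M. dist (coord (X m) i) (coord (X n) i) < e"
      by blast
  qed
  then have "\<exists>l. (\<lambda>n. coord (X n) i) \<longlonglongrightarrow> l" for i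
    by (metis Cauchy_convergent convergent_def)
  then obtain L where L: "\<And>i. (\<lambda>n. coord (X n) i) \<longlonglongrightarrow> L i"
    by metis
  \<comment> \<open>Finite partial sums allow the limit in \<open>m\<close> to be taken termwise.
    The bound is uniform in \<open>N\<close>, so it later yields both summability and convergence in
    norm.\<close>
  have close: "\<exists>M. \<forall>n\<ge>M. \<forall>N. (\<Sum>i<N. (L i - coord (X n) i)\<^sup>2) \<le> e\<^sup>2" if e: "e > 0" for e
  proof -
    obtain M where M: "\<And>m n. m \<ge> M \<Longrightarrow> n \<ge> M \<Longrightarrow> norm (X m - X n) < e"
      using \<open>Cauchy X\<close> e unfolding Cauchy_def dist_norm by blast
    show ?thesis
    proof (intro exI allI impI)
      fix n N
      assume "n \<ge> M"
      have "(\<lambda>m. \<Sum>i<N. (coord (X m) i - coord (X n) i)\<^sup>2) \<longlonglongrightarrow> (\<Sum>i<N. (L i - coord (X n) i)\<^sup>2)"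
        by (intro tendsto_intros L)
      moreover have "\<forall>\<^sub>F m in sequentially. (\<Sum>i<N. (coord (X m) i - coord (X n) i)\<^sup>2) \<le> e\<^sup>2"
        using eventually_ge_at_top[of M]
      proof eventually_elim
        case (elim m)
        have "(\<Sum>i<N. (coord (X m) i - coord (X n) i)\<^sup>2) \<le> (norm (X m - X n))\<^sup>2"
          using sum_coord_sq_le[of "X m - X n" N] by simp
        also have "\<dots> \<le> e\<^sup>2"
          using M[OF elim \<open>n \<ge> M\<close>] by (intro power_mono) auto
        finally show ?case .
      qed
      ultimately show "(\<Sum>i<N. (L i - coord (X n) i)\<^sup>2) \<le> e\<^sup>2"
        by (intro tendsto_upperbound) auto
    qed
  qed
  have summ: "summable (\<lambda>i. (L i - coord (X n) i)\<^sup>2)" 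
    if "\<forall>N. (\<Sum>i<N. (L i - coord (X n) i)\<^sup>2) \<le> e\<^sup>2" for e n
    using that by (intro summableI_nonneg_bounded[of _ "e\<^sup>2"]) auto
  obtain n where "summable (\<lambda>i. (L i - coord (X n) i)\<^sup>2)"
    using close[of 1] summ[where e = 1] by auto
  from summable_sq_add[OF this summable_coord_sq[of "X n"]] have "summable (\<lambda>i. (L i)\<^sup>2)"
    by simp
  then have coordl: "coord (Abs_ell2 L) = L"
    by (simp add: Abs_ell2_inverse)
  have "X \<longlonglongrightarrow> Abs_ell2 L"
  proof (rule LIMSEQ_I)
    fix e :: real
    assume "e > 0"
    then obtain M where M: "\<And>n N. n \<ge> M \<Longrightarrow> (\<Sum>i<N. (L i - coord (X n) i)\<^sup>2) \<le> (e / 2)\<^sup>2"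
      using close[of "e / 2"] by auto
    have "norm (X n - Abs_ell2 L) < e" if "n \<ge> M" for n
    proof -
      have "(norm (Abs_ell2 L - X n))\<^sup>2 \<le> (e / 2)\<^sup>2"
        unfolding norm_ell2_sq coord_simps coordl
        using M[OF that] by (intro suminf_le_const summ) auto
      then have "norm (Abs_ell2 L - X n) \<le> e / 2"
        using \<open>e > 0\<close> by (simp add: power2_le_iff_abs_le)
      then show ?thesis
        using \<open>e > 0\<close> by (simp add: norm_minus_commute)
    qed
    then show "\<exists>M. \<forall>n\<ge>M. norm (X n - Abs_ell2 L) < e"
      by auto
  qed
  then show "convergent X"
    by (auto simp: convergent_def)
qed

lemma ell2_finite_approx:
  assumes "e > 0"
  obtains N where "norm (x - (\<Sum>i<N. coord x i *\<^sub>R ell2_unit i)) < e"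
proof -
  obtain N where N: "norm (\<Sum>i. (coord x (i + N))\<^sup>2) < e\<^sup>2"
    using suminf_exist_split[OF zero_less_power[OF assms, of 2] summable_coord_sq[of x]] by blast
  define d where "d = x - (\<Sum>i<N. coord x i *\<^sub>R ell2_unit i)"
  have "coord d k = (if k < N then 0 else coord x k)" for k
  proof -
    have "coord d k = coord x k - (\<Sum>i<N. coord x i * (if k = i then 1 else 0))"
      unfolding d_def inner_unit[symmetric] inner_diff_left inner_sum_left inner_scaleR_left
      by (simp add: inner_unit coord_unit)
    moreover have "(\<Sum>i<N. coord x i * (if k = i then 1 else 0)) = (\<Sum>i<N. if k = i then coord x i else 0)"
      by (intro sum.cong) auto
    ultimately show ?thesis
      by simp
  qed
  then have "(norm d)\<^sup>2 = (\<Sum>i. (coord x (i + N))\<^sup>2)"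
    unfolding norm_ell2_sq using suminf_split_initial_segment[OF summable_coord_sq[of d], of N]
    by simp
  then have "norm d < e"
    using N assms by (intro power2_less_imp_less[of _ e]) (auto simp: abs_less_iff)
  then show ?thesis
    using that by (simp add: d_def)
qed

text \<open>Finite combinations of unit vectors with rational coefficients are dense: first cut off
  the tail, then approximate each remaining coordinate.\<close>

lemma ell2_separable:
  obtains D :: "ell2 set" where "countable D" and "\<And>U. open U \<Longrightarrow> U \<noteq> {} \<Longrightarrow> \<exists>d\<in>D. d \<in> U"
proof
  define F where "F qs = (\<Sum>i<length qs. real_of_rat (qs ! i) *\<^sub>R ell2_unit i)" for qs
  show "countable (range F)"
    by simp
  fix U :: "ell2 set"
  assume "open U" "U \<noteq> {}"
  then obtain x e where "e > 0" and e: "ball x e \<subseteq> U"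
    by (meson ex_in_conv open_contains_ball)
  obtain N where N: "norm (x - (\<Sum>i<N. coord x i *\<^sub>R ell2_unit i)) < e / 2"
    using ell2_finite_approx[of "e / 2" x] \<open>e > 0\<close> by auto
  \<comment> \<open>\<open>N\<close> such errors add up to less than \<open>e / 2\<close>; the
    \<open>+ 1\<close> also covers \<open>N = 0\<close>.\<close>
  have "\<exists>q. \<bar>coord x i - real_of_rat q\<bar> < e / (2 * (real N + 1))" for i
  proof -
    have "coord x i < coord x i + e / (2 * (real N + 1))"
      using \<open>e > 0\<close> by simp
    from of_rat_dense[OF this] obtain r where
      "coord x i < real_of_rat r" "real_of_rat r < coord x i + e / (2 * (real N + 1))"
      by blast
    then show ?thesis
      by (intro exI[of _ r]) linarith
  qed
  then obtain q where q: "\<And>i. \<bar>coord x i - real_of_rat (q i)\<bar> < e / (2 * (real N + 1))"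
    by metis
  have F: "F (map q [0..<N]) = (\<Sum>i<N. real_of_rat (q i) *\<^sub>R ell2_unit i)"
    unfolding F_def by (intro sum.cong) auto
  have "norm ((\<Sum>i<N. coord x i *\<^sub>R ell2_unit i) - F (map q [0..<N]))
      = norm (\<Sum>i<N. (coord x i - real_of_rat (q i)) *\<^sub>R ell2_unit i)"
    by (simp add: F sum_subtractf scaleR_diff_left)
  also have "\<dots> \<le> (\<Sum>i<N. e / (2 * (real N + 1)))"
    using q by (intro sum_norm_le) (simp add: norm_unit less_imp_le)
  also have "\<dots> < e / 2"
    using \<open>e > 0\<close> by (simp add: field_simps)
  finally have "norm (x - F (map q [0..<N])) < e"
    using N norm_triangle_ineq[of "x - (\<Sum>i<N. coord x i *\<^sub>R ell2_unit i)"
        "(\<Sum>i<N. coord x i *\<^sub>R ell2_unit i) - F (map q [0..<N])"] by simp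
  then show "\<exists>d\<in>range F. d \<in> U"
    using e by (auto simp: subset_iff dist_norm)
qed

text \<open>Balls of radius \<open>1 / (n + 1)\<close> about a countable dense set form a basis.
  Second countability later provides a countable dense part of each graph.\<close>

instance ell2 :: second_countable_topology
proof
  obtain D :: "ell2 set" where "countable D"
    and D: "\<And>U. open U \<Longrightarrow> U \<noteq> {} \<Longrightarrow> \<exists>d\<in>D. d \<in> U"
    using ell2_separable by blast
  define B where "B = (\<lambda>(d, n). ball d (1 / real (Suc n))) ` (D \<times> UNIV)"
  have "topological_basis B"
  proof (rule topological_basisI)
    show "open b" if "b \<in> B" for b
      using that by (auto simp: B_def)
    fix U and x :: ell2
    assume "open U" "x \<in> U"
    then obtain e where "e > 0" "ball x e \<subseteq> U"
      by (meson open_contains_ball)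
    obtain n where n: "1 / real (Suc n) < e / 2"
      using \<open>e > 0\<close> reals_Archimedean[of "e / 2"] by (auto simp: field_simps)
    obtain d where "d \<in> D" "d \<in> ball x (1 / real (Suc n))"
      using D[of "ball x (1 / real (Suc n))"] by auto
    moreover have "ball d (1 / real (Suc n)) \<subseteq> ball x e"
    proof
      fix y
      assume "y \<in> ball d (1 / real (Suc n))"
      then show "y \<in> ball x e"
        using dist_triangle[of x y d] n calculation(2) unfolding mem_ball by linarith
    qed
    ultimately show "\<exists>b\<in>B. x \<in> b \<and> b \<subseteq> U"
      using \<open>ball x e \<subseteq> U\<close>
      by (intro bexI[of _ "ball d (1 / real (Suc n))"]) (auto simp: B_def dist_commute)
  qed
  moreover have "countable B"
    unfolding B_def using \<open>countable D\<close> by simp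
  ultimately show "\<exists>B :: ell2 set set. countable B \<and> open = generate_topology B"
    by (intro exI[of _ B] conjI topological_basis_imp_subbasis)
qed

subsection \<open>Cantor schemes\<close>

text \<open>After any choice of \<open>p0\<close>, a point \<open>p1\<close> is found by avoiding
  the finitely many level sets of \<open>g 0, ..., g n\<close> through \<open>p0\<close>; continuity
  then keeps small balls around both points separated.\<close>

lemma cantor_scheme_step:
  fixes S :: "'a::metric_space set" and g :: "nat \<Rightarrow> 'a \<Rightarrow> real"
  assumes V: "open V" "\<And>U. open U \<Longrightarrow> U \<inter> S \<noteq> {} \<Longrightarrow> U \<inter> V \<inter> S \<noteq> {}"
    and g: "\<And>k. continuous_on UNIV (g k)"
    and nc: "\<And>k c U. open U \<Longrightarrow> U \<inter> S \<noteq> {} \<Longrightarrow> \<exists>z\<in>U \<inter> S. g k z \<noteq> c"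
    and p: "p \<in> S" "r > 0"
  obtains p0 p1 t where "p0 \<in> S" "p1 \<in> S" "0 < t" "t \<le> r / 2"
    "cball p0 t \<subseteq> ball p r \<inter> V" "cball p1 t \<subseteq> ball p r \<inter> V"
    "\<forall>k\<le>n. \<forall>x\<in>cball p0 t. \<forall>y\<in>cball p1 t. g k x \<noteq> g k y"
proof -
  have ball: "open (ball p r \<inter> V)" "ball p r \<inter> V \<inter> S \<noteq> {}"
    using V(1) V(2)[of "ball p r"] p centre_in_ball[of p r] by blast+
  then obtain p0 where p0: "p0 \<in> S" "p0 \<in> ball p r \<inter> V"
    by blast
  have opn: "open {z. g k z \<noteq> c}" for k c
    using g[of k] by (intro open_Collect_neq) auto
  \<comment> \<open>The inequalities are imposed one at a time: each is an open condition, so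
    \<open>nc\<close> applies again to what remains.\<close>
  have "open {z. \<forall>k<m. g k z \<noteq> g k p0} \<and> ball p r \<inter> V \<inter> {z. \<forall>k<m. g k z \<noteq> g k p0} \<inter> S \<noteq> {}" for m
  proof (induction m)
    case 0
    then show ?case using ball by simp
  next
    case (Suc m)
    have eq: "{z. \<forall>k<Suc m. g k z \<noteq> g k p0} = {z. \<forall>k<m. g k z \<noteq> g k p0} \<inter> {z. g m z \<noteq> g m p0}"
      by (auto simp: less_Suc_eq)
    have "\<exists>z\<in>(ball p r \<inter> V \<inter> {z. \<forall>k<m. g k z \<noteq> g k p0}) \<inter> S. g m z \<noteq> g m p0"
      using Suc ball by (intro nc) auto
    then show ?case
      unfolding eq using Suc opn by blast
  qed
  from this[of "Suc n"] obtain p1 where p1: "p1 \<in> S" "p1 \<in> ball p r \<inter> V"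
    and sep: "\<And>k. k \<le> n \<Longrightarrow> g k p1 \<noteq> g k p0"
    unfolding less_Suc_eq_le by blast
  \<comment> \<open>Within half the gap between \<open>g k p0\<close> and \<open>g k p1\<close>,
    values near \<open>p0\<close> cannot meet values near \<open>p1\<close>.\<close>
  define W where "W q = (\<Inter>k\<le>n. {x. \<bar>g k x - g k q\<bar> < \<bar>g k p0 - g k p1\<bar> / 2})" for q
  have oW: "open (W q)" for q
    unfolding W_def using g by (intro open_INT ballI open_Collect_less continuous_intros) auto
  have "open (ball p r \<inter> V \<inter> W p0)" "p0 \<in> ball p r \<inter> V \<inter> W p0"
    using ball oW p0 sep[symmetric] by (auto simp: W_def)
  then obtain t0 where t0: "t0 > 0" "cball p0 t0 \<subseteq> ball p r \<inter> V \<inter> W p0"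
    by (meson open_contains_cball)
  have "open (ball p r \<inter> V \<inter> W p1)" "p1 \<in> ball p r \<inter> V \<inter> W p1"
    using ball oW p1 sep[symmetric] by (auto simp: W_def)
  then obtain t1 where t1: "t1 > 0" "cball p1 t1 \<subseteq> ball p r \<inter> V \<inter> W p1"
    by (meson open_contains_cball)
  define t where "t = min (r / 2) (min t0 t1)"
  have t: "0 < t" "t \<le> r / 2" "t \<le> t0" "t \<le> t1"
    using t0 t1 p by (auto simp: t_def)
  have sub: "cball p0 t \<subseteq> ball p r \<inter> V \<inter> W p0" "cball p1 t \<subseteq> ball p r \<inter> V \<inter> W p1"
    using t0 t1 t subset_cball by (meson order_trans)+
  have "g k x \<noteq> g k y" if "k \<le> n" "x \<in> cball p0 t" "y \<in> cball p1 t" for k x y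
  proof -
    have "x \<in> W p0" "y \<in> W p1"
      using that sub by auto
    then have "\<bar>g k x - g k p0\<bar> < \<bar>g k p0 - g k p1\<bar> / 2" "\<bar>g k y - g k p1\<bar> < \<bar>g k p0 - g k p1\<bar> / 2"
      using that by (auto simp: W_def)
    then show ?thesis
      by (auto simp: abs_if split: if_splits)
  qed
  with that[of p0 p1 t] p0 p1 t sub show ?thesis
    by blast
qed

text \<open>Siblings on level \<open>n\<close> of the Cantor scheme are separated only by \<open>g 0, \<dots>, g n\<close>; so
  \<open>g k\<close> is not injective, but at most \<open>2 ^ k\<close> branches share a value of it.\<close>

lemma cantor_scheme:
  fixes S :: "'a::complete_space set" and V :: "nat \<Rightarrow> 'a set" and g :: "nat \<Rightarrow> 'a \<Rightarrow> real"
  assumes ne: "S \<noteq> {}"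
    and V: "\<And>n. open (V n)" "\<And>n U. open U \<Longrightarrow> U \<inter> S \<noteq> {} \<Longrightarrow> U \<inter> V n \<inter> S \<noteq> {}"
    and g: "\<And>k. continuous_on UNIV (g k)"
    and nc: "\<And>k c U. open U \<Longrightarrow> U \<inter> S \<noteq> {} \<Longrightarrow> \<exists>z\<in>U \<inter> S. g k z \<noteq> c"
  obtains \<phi> :: "nat set \<Rightarrow> 'a"
  where "\<And>a. \<phi> a \<in> closure S" "\<And>a n. \<phi> a \<in> V n" "\<And>k c. finite {a. g k (\<phi> a) = c}"
proof -
  \<comment> \<open>A node of the scheme is a pair of centre and radius; \<open>q0\<close> and
    \<open>q1\<close> are the children of \<open>q\<close> on level \<open>n\<close>.\<close>
  define split where "split q n q0 q1 \<longleftrightarrow>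
     fst q0 \<in> S \<and> fst q1 \<in> S \<and> 0 < snd q0 \<and> snd q0 \<le> snd q / 2 \<and> 0 < snd q1 \<and> snd q1 \<le> snd q / 2 \<and>
     cball (fst q0) (snd q0) \<subseteq> ball (fst q) (snd q) \<inter> V n \<and>
     cball (fst q1) (snd q1) \<subseteq> ball (fst q) (snd q) \<inter> V n \<and>
     (\<forall>k\<le>n. \<forall>x\<in>cball (fst q0) (snd q0). \<forall>y\<in>cball (fst q1) (snd q1). g k x \<noteq> g k y)"
    for q q0 q1 :: "'a \<times> real" and n
  have "\<exists>q0 q1. fst q \<in> S \<and> snd q > 0 \<longrightarrow> split q n q0 q1" for q n
  proof (cases "fst q \<in> S \<and> snd q > 0")
    case True
    then have q: "fst q \<in> S" "snd q > 0"
      by auto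
    obtain p0 p1 t where "p0 \<in> S" "p1 \<in> S" "0 < t" "t \<le> snd q / 2"
      "cball p0 t \<subseteq> ball (fst q) (snd q) \<inter> V n" "cball p1 t \<subseteq> ball (fst q) (snd q) \<inter> V n"
      "\<forall>k\<le>n. \<forall>x\<in>cball p0 t. \<forall>y\<in>cball p1 t. g k x \<noteq> g k y"
      by (rule cantor_scheme_step[where V = "V n" and g = g and n = n, OF V(1) V(2) g nc q])
    then have "split q n (p0, t) (p1, t)"
      by (simp add: split_def)
    then show ?thesis
      by blast
  qed blast
  then obtain F0 F1 where F01: "\<And>q n. fst q \<in> S \<Longrightarrow> snd q > 0 \<Longrightarrow> split q n (F0 q n) (F1 q n)"
    by metis
  note F = F01[unfolded split_def]
  obtain p where "p \<in> S"
    using ne by auto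
  \<comment> \<open>The set \<open>a\<close> is a branch: \<open>n \<in> a\<close> decides which
    child is taken on level \<open>n\<close>.\<close>
  define st where "st a = rec_nat (p, 1 :: real) (\<lambda>n q. if n \<in> a then F1 q n else F0 q n)" for a :: "nat set"
  define B where "B a n = cball (fst (st a n)) (snd (st a n))" for a n
  have st_Suc: "st a (Suc n) = (if n \<in> a then F1 (st a n) n else F0 (st a n) n)" for a n
    by (simp add: st_def)
  have inv: "fst (st a n) \<in> S \<and> 0 < snd (st a n) \<and> snd (st a n) \<le> 1 / 2 ^ n" for a n
  proof (induction n)
    case 0
    then show ?case using \<open>p \<in> S\<close> by (simp add: st_def)
  next
    case (Suc n)
    then show ?case
      using F[of "st a n" n] unfolding st_Suc by auto
  qed
  have B_Suc: "B a (Suc n) \<subseteq> B a n \<inter> V n" for a n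
  proof -
    have "B a (Suc n) \<subseteq> ball (fst (st a n)) (snd (st a n)) \<inter> V n"
      using F[of "st a n" n] inv[of a n] unfolding st_Suc B_def by (cases "n \<in> a") auto
    then show ?thesis
      using ball_subset_cball[of "fst (st a n)" "snd (st a n)"] unfolding B_def by blast
  qed
  have B_mono: "m \<le> n \<Longrightarrow> B a n \<subseteq> B a m" for a m n
    by (rule lift_Suc_antimono_le[of "B a"]) (use B_Suc in auto)
  have small: "\<exists>n. \<forall>x\<in>B a n. \<forall>y\<in>B a n. dist x y < e" if e: "e > 0" for a e
  proof -
    obtain n where n: "(1 / 2) ^ n < e / 2"
      using e real_arch_pow_inv[of "e / 2" "1 / 2"] by auto
    have "dist x y < e" if "x \<in> B a n" "y \<in> B a n" for x y
      using that inv[of a n] n dist_triangle3[of x y "fst (st a n)"]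
      by (auto simp: B_def power_divide)
    then show ?thesis
      by blast
  qed
  have "\<exists>z. \<forall>n. z \<in> B a n" for a
  proof -
    have "closed (B a n)" "B a n \<noteq> {}" for n
      using inv[of a n] by (auto simp: B_def)
    then show ?thesis
      using decreasing_closed_nest[of "B a" "\<exists>z. \<forall>n. z \<in> B a n"] B_mono small by blast
  qed
  then obtain \<phi> where \<phi>: "\<And>a n. \<phi> a \<in> B a n"
    by metis
  show ?thesis
  proof
    fix a
    show "\<phi> a \<in> closure S"
      unfolding closure_approachable
    proof (intro allI impI)
      fix e :: real
      assume "e > 0"
      then obtain n where "\<forall>x\<in>B a n. \<forall>y\<in>B a n. dist x y < e"
        using small by blast
      moreover have "fst (st a n) \<in> B a n"
        using inv[of a n] by (simp add: B_def)
      ultimately show "\<exists>y\<in>S. dist y (\<phi> a) < e"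
        using \<phi> inv[of a n] by blast
    qed
    show "\<phi> a \<in> V n" for n
      using \<phi>[of a "Suc n"] B_Suc by blast
  next
    fix k c
    have cong: "st a n = st b n" if "a \<inter> {..<n} = b \<inter> {..<n}" for a b n
      using that
    proof (induction n)
      case 0
      then show ?case by (simp add: st_def)
    next
      case (Suc n)
      then have "a \<inter> {..<n} = b \<inter> {..<n}" "n \<in> a \<longleftrightarrow> n \<in> b"
        by (auto simp: set_eq_iff less_Suc_eq)
      then show ?case
        using Suc.IH by (simp add: st_Suc)
    qed
    have sep: "g k (\<phi> a) \<noteq> g k (\<phi> b)"
      if "a \<inter> {..<n} = b \<inter> {..<n}" "n \<in> b" "n \<notin> a" "k \<le> n" for a b n
    proof -
      have "\<phi> a \<in> cball (fst (F0 (st a n) n)) (snd (F0 (st a n) n))"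
        using \<phi>[of a "Suc n"] that(3) by (simp add: B_def st_Suc)
      moreover have "\<phi> b \<in> cball (fst (F1 (st a n) n)) (snd (F1 (st a n) n))"
        using \<phi>[of b "Suc n"] that(2) cong[OF that(1)] by (simp add: B_def st_Suc)
      moreover have "\<forall>x\<in>cball (fst (F0 (st a n) n)) (snd (F0 (st a n) n)).
          \<forall>y\<in>cball (fst (F1 (st a n) n)) (snd (F1 (st a n) n)). g k x \<noteq> g k y"
        using F01[of "st a n" n] inv[of a n] that(4) unfolding split_def by blast
      ultimately show ?thesis
        by blast
    qed
    \<comment> \<open>Distinct branches that agree below \<open>k\<close> first part at a level
      \<open>n \<ge> k\<close>, where \<open>g k\<close> is among the separating functions. So a
      fibre of \<open>g k\<close> injects into the subsets of \<open>{..<k}\<close>.\<close>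
    have "inj_on (\<lambda>a. a \<inter> {..<k}) {a. g k (\<phi> a) = c}"
    proof (rule inj_onI, rule ccontr)
      fix a b
      assume ab: "a \<in> {a. g k (\<phi> a) = c}" "b \<in> {a. g k (\<phi> a) = c}" "a \<inter> {..<k} = b \<inter> {..<k}" "a \<noteq> b"
      define n where "n = (LEAST n. (n \<in> a) \<noteq> (n \<in> b))"
      have "\<exists>n. (n \<in> a) \<noteq> (n \<in> b)"
        using ab(4) by blast
      then have n: "(n \<in> a) \<noteq> (n \<in> b)"
        unfolding n_def by (rule LeastI_ex)
      have "(m \<in> a) = (m \<in> b)" if "m < n" for m
        using not_less_Least[of m "\<lambda>n. (n \<in> a) \<noteq> (n \<in> b)"] that by (simp add: n_def)
      then have eq: "a \<inter> {..<n} = b \<inter> {..<n}"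
        by auto
      have "k \<le> n"
      proof (rule ccontr)
        assume "\<not> k \<le> n"
        then have "n \<in> a \<longleftrightarrow> n \<in> a \<inter> {..<k}" "n \<in> b \<longleftrightarrow> n \<in> b \<inter> {..<k}"
          by auto
        with n ab(3) show False
          by blast
      qed
      from n have "g k (\<phi> a) \<noteq> g k (\<phi> b)"
        using sep[OF eq _ _ \<open>k \<le> n\<close>] sep[OF eq[symmetric] _ _ \<open>k \<le> n\<close>] by metis
      then show False
        using ab(1,2) by simp
    qed
    moreover have "finite ((\<lambda>a. a \<inter> {..<k}) ` {a. g k (\<phi> a) = c})"
      by (rule finite_subset[of _ "Pow {..<k}"]) auto
    ultimately show "finite {a. g k (\<phi> a) = c}"
      using finite_imageD by blast
  qed
qed

subsection \<open>Transfinite recursion\<close>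

text \<open>The type \<open>nat set\<close> serves as the set of cardinality continuum.\<close>

lemma card_UNION_countable_less:
  assumes "|I| <o |UNIV :: nat set set|" and "\<And>i. i \<in> I \<Longrightarrow> countable (A i)"
  shows "|\<Union>i\<in>I. A i| <o |UNIV :: nat set set|"
proof -
  have inf: "infinite (UNIV :: nat set set)"
    by (simp add: Finite_Set.finite_set)
  have "\<not> |UNIV :: nat set set| \<le>o |UNIV :: nat set|"
  proof
    assume "|UNIV :: nat set set| \<le>o |UNIV :: nat set|"
    then obtain f :: "nat set \<Rightarrow> nat" where "inj f"
      unfolding card_of_ordLeq[symmetric] by blast
    then have "range (inv f) = Pow UNIV"
      using inj_imp_surj_inv by auto
    then show False
      using Cantors_theorem[of UNIV] by blast
  qed
  then have nat: "|UNIV :: nat set| <o |UNIV :: nat set set|"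
    using not_ordLess_iff_ordLeq[OF card_of_Well_order card_of_Well_order] by blast
  let ?B = "I <+> (UNIV :: nat set)"
  have "|\<Union>i\<in>I. A i| \<le>o |?B|"
  proof (rule card_of_UNION_ordLeq_infinite)
    show "infinite ?B"
      by (simp add: finite_Plus_iff)
    show "|I| \<le>o |?B|"
      by (rule card_of_Plus1)
    show "\<forall>i\<in>I. |A i| \<le>o |?B|"
    proof
      fix i
      assume "i \<in> I"
      then have "|A i| \<le>o |UNIV :: nat set|"
        using assms(2) by (auto simp: countable_def card_of_ordLeq[symmetric])
      then show "|A i| \<le>o |?B|"
        using card_of_Plus2 ordLeq_transitive by blast
    qed
  qed
  also have "|?B| <o |UNIV :: nat set set|"
    by (rule card_of_Plus_ordLess_infinite[OF inf assms(1) nat])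
  finally show ?thesis .
qed

lemma countable_card_less: "countable A \<Longrightarrow> |A| <o |UNIV :: nat set set|"
  using card_UNION_countable_less[of "{()}" "\<lambda>_. A"]
    finite_ordLess_infinite[OF card_of_Well_order card_of_Well_order, of "{()}" "UNIV :: nat set set"]
  by (simp add: Finite_Set.finite_set Field_card_of)

text \<open>A construction in the style of Bernstein sets. A pair \<open>(C, y)\<close> of
  \<open>R i\<close> offers to put \<open>C\<close> into \<open>X\<close> and keep \<open>y\<close>
  out. Before each stage fewer than continuum many elements have been decided, so a task that no
  small set \<open>A\<close> can block still has a pair disjoint from them.\<close>

lemma bernstein_recursion:
  fixes R :: "'i \<Rightarrow> ('a set \<times> 'a) set" and X0 :: "'a set"
  assumes I: "|UNIV :: 'i set| \<le>o |UNIV :: nat set set|"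
    and X0: "countable X0"
    and R: "\<And>i C y. (C, y) \<in> R i \<Longrightarrow> countable C \<and> y \<notin> C"
  obtains X where "X0 \<subseteq> X"
    "\<forall>i. (\<forall>A. |A| <o |UNIV :: nat set set| \<longrightarrow> (\<exists>(C, y)\<in>R i. C \<inter> A = {} \<and> y \<notin> A)) \<longrightarrow>
      (\<exists>(C, y)\<in>R i. C \<subseteq> X \<and> y \<notin> X)"
proof -
  define J where "J = {i. \<forall>A. |A| <o |UNIV :: nat set set| \<longrightarrow> (\<exists>(C, y)\<in>R i. C \<inter> A = {} \<and> y \<notin> A)}"
  \<comment> \<open>The cardinal well-order of \<open>J\<close> keeps every proper initial segment
    below the continuum, even when \<open>J\<close> has that size.\<close>
  define r where "r = |J|"
  have wo: "Well_order r" and Fr: "Field r = J"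
    using card_of_Well_order[of J] by (simp_all add: r_def Field_card_of)
  have wf: "wf (r - Id)"
    using wo by (simp add: well_order_on_def)
  have under: "|underS r i| <o |UNIV :: nat set set|" if "i \<in> J" for i
  proof -
    have "|underS r i| <o r"
      using that card_of_underS[OF card_of_Card_order[of J], of i] by (simp add: r_def Field_card_of)
    also have "r \<le>o |UNIV :: 'i set|"
      by (simp add: r_def card_of_mono1)
    finally show ?thesis
      using I ordLess_ordLeq_trans by blast
  qed
  \<comment> \<open>Everything decided before stage \<open>i\<close>, whether put into
    \<open>X\<close> or kept out of it.\<close>
  define A where "A c i = X0 \<union> (\<Union>j\<in>underS r i. fst (c j) \<union> {snd (c j)})" for c :: "'i \<Rightarrow> 'a set \<times> 'a" and i
  define H where "H c i = (SOME q. q \<in> R i \<and> fst q \<inter> A c i = {} \<and> snd q \<notin> A c i)" for c i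
  define c where "c = wfrec (r - Id) H"
  have adm: "adm_wf (r - Id) H"
    unfolding adm_wf_def
  proof (intro allI impI)
    fix f g :: "'i \<Rightarrow> 'a set \<times> 'a" and x
    assume "\<forall>z. (z, x) \<in> r - Id \<longrightarrow> f z = g z"
    then have "A f x = A g x"
      unfolding A_def by (auto simp: underS_def)
    then show "H f x = H g x"
      by (simp add: H_def)
  qed
  have c_eq: "c i = H c i" for i
    using wfrec_fixpoint[OF wf adm] unfolding c_def by metis
  have c: "c i \<in> R i \<and> fst (c i) \<inter> A c i = {} \<and> snd (c i) \<notin> A c i" if "i \<in> J" for i
    using that
  proof (induction i rule: wf_induct_rule[OF wf])
    case (1 i)
    have "|\<Union>j\<in>underS r i. fst (c j) \<union> {snd (c j)}| <o |UNIV :: nat set set|"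
    proof (rule card_UNION_countable_less[OF under[OF 1(2)]])
      fix j
      assume j: "j \<in> underS r i"
      then have "j \<in> J"
        using Fr by (auto simp: underS_def Field_def)
      with j 1 have "c j \<in> R j"
        by (auto simp: underS_def)
      then show "countable (fst (c j) \<union> {snd (c j)})"
        using R[of "fst (c j)" "snd (c j)" j] by auto
    qed
    then have "|A c i| <o |UNIV :: nat set set|"
      unfolding A_def using countable_card_less[OF X0]
      by (intro card_of_Un_ordLess_infinite) (auto simp: Finite_Set.finite_set)
    then have "\<exists>(C, y)\<in>R i. C \<inter> A c i = {} \<and> y \<notin> A c i"
      using 1(2) by (simp add: J_def)
    then have "\<exists>q. q \<in> R i \<and> fst q \<inter> A c i = {} \<and> snd q \<notin> A c i"
      by auto
    from someI_ex[OF this] show ?case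
      unfolding c_eq[of i] H_def .
  qed
  define X where "X = X0 \<union> (\<Union>i\<in>J. fst (c i))"
  show ?thesis
  proof
    show "X0 \<subseteq> X"
      by (simp add: X_def)
  next
    show "\<forall>i. (\<forall>A. |A| <o |UNIV :: nat set set| \<longrightarrow> (\<exists>(C, y)\<in>R i. C \<inter> A = {} \<and> y \<notin> A)) \<longrightarrow>
      (\<exists>(C, y)\<in>R i. C \<subseteq> X \<and> y \<notin> X)"
    proof (intro allI impI)
      fix i
      assume "\<forall>A. |A| <o |UNIV :: nat set set| \<longrightarrow> (\<exists>(C, y)\<in>R i. C \<inter> A = {} \<and> y \<notin> A)"
      then have i: "i \<in> J"
        by (simp add: J_def)
      \<comment> \<open>The later of the two stages respects the earlier one: a later
        \<open>C\<close> avoids old excluded points, and a later \<open>y\<close> avoids old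
        included sets. Within one stage \<open>R\<close> ensures
        \<open>y \<notin> C\<close>.\<close>
      have "snd (c i) \<notin> fst (c j)" if j: "j \<in> J" for j
      proof -
        have "Total r"
          using wo by (simp add: well_order_on_def linear_order_on_def)
        then consider "i = j" | "i \<in> underS r j" | "j \<in> underS r i"
          using i j Fr by (auto simp: total_on_def underS_def)
        then show ?thesis
        proof cases
          case 1
          then show ?thesis
            using c[OF i] R[of "fst (c i)" "snd (c i)" i] by simp
        next
          case 2
          then have "snd (c i) \<in> A c j"
            by (auto simp: A_def)
          then show ?thesis
            using c[OF j] by blast
        next
          case 3
          then have "fst (c j) \<subseteq> A c i"
            by (auto simp: A_def)
          then show ?thesis
            using c[OF i] by blast
        qed
      qed
      moreover have "snd (c i) \<notin> X0"
        using c[OF i] by (simp add: A_def)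
      ultimately have "snd (c i) \<notin> X" "fst (c i) \<subseteq> X"
        using i by (auto simp: X_def)
      then show "\<exists>(C, y)\<in>R i. C \<subseteq> X \<and> y \<notin> X"
        using c[OF i] by (auto intro!: bexI[of _ "c i"] simp: case_prod_beta)
    qed
  qed
qed

subsection \<open>Extensions of continuous functions\<close>

text \<open>The oscillation of the sampled values at \<open>fst z\<close> is bounded. Stating this
  for pairs lets these sets serve as open sets of a Cantor scheme on graphs.\<close>

definition graph_osc :: "(nat \<Rightarrow> 'a::metric_space \<times> 'b::metric_space) \<Rightarrow> nat \<Rightarrow> ('a \<times> 'b) set" where
  "graph_osc s k = {z. \<exists>\<delta>>0. \<forall>m n. dist (fst (s m)) (fst z) < \<delta> \<longrightarrow> dist (fst (s n)) (fst z) < \<delta> \<longrightarrow>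
     dist (snd (s m)) (snd (s n)) < 1 / Suc k}"

text \<open>If \<open>s\<close> enumerates a dense part of the graph of a continuous function, then \<open>graph_hull s\<close> is the
  graph of its maximal continuous extension, as in Lavrentiev's theorem.\<close>

definition graph_hull :: "(nat \<Rightarrow> 'a::metric_space \<times> 'b::metric_space) \<Rightarrow> ('a \<times> 'b) set" where
  "graph_hull s = closure (range s) \<inter> (\<Inter>k. graph_osc s k)"

lemma open_graph_osc: "open (graph_osc s k)"
  unfolding open_contains_ball
proof
  fix z
  assume "z \<in> graph_osc s k"
  then obtain \<delta> where "\<delta> > 0" and \<delta>: "\<And>m n. dist (fst (s m)) (fst z) < \<delta> \<Longrightarrow>
      dist (fst (s n)) (fst z) < \<delta> \<Longrightarrow> dist (snd (s m)) (snd (s n)) < 1 / Suc k"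
    unfolding graph_osc_def by blast
  have "z' \<in> graph_osc s k" if z': "dist z z' < \<delta> / 2" for z'
  proof -
    have "dist (fst z') (fst z) < \<delta> / 2"
      using z' dist_fst_le[of z z'] by (simp add: dist_commute)
    then have "dist (fst (s m)) (fst z) < \<delta>" if "dist (fst (s m)) (fst z') < \<delta> / 2" for m
      using dist_triangle[of "fst (s m)" "fst z" "fst z'"] that by linarith
    then have "\<forall>m n. dist (fst (s m)) (fst z') < \<delta> / 2 \<longrightarrow> dist (fst (s n)) (fst z') < \<delta> / 2 \<longrightarrow>
        dist (snd (s m)) (snd (s n)) < 1 / Suc k"
      using \<delta> by blast
    moreover have "\<delta> / 2 > 0"
      using \<open>\<delta> > 0\<close> by simp
    ultimately show ?thesis
      unfolding graph_osc_def by blast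
  qed
  then show "\<exists>e>0. ball z e \<subseteq> graph_osc s k"
    using \<open>\<delta> > 0\<close> by (intro exI[of _ "\<delta> / 2"]) auto
qed

text \<open>Samples near \<open>(x, y)\<close> and \<open>(x, y')\<close> have first components near
  \<open>x\<close>, so small oscillation brings their second components together; three distances
  below a third of \<open>dist y y'\<close> are then contradictory.\<close>

lemma graph_hull_single_valued:
  assumes "(x, y) \<in> graph_hull s" "(x, y') \<in> graph_hull s"
  shows "y = y'"
proof (rule ccontr)
  assume "y \<noteq> y'"
  then obtain k where k: "1 / Suc k < dist y y' / 3"
    using nat_approx_posE[of "dist y y' / 3"] by (metis zero_less_dist_iff zero_less_divide_iff zero_less_numeral)
  obtain \<delta> where "\<delta> > 0" and \<delta>: "\<And>m n. dist (fst (s m)) x < \<delta> \<Longrightarrow>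
      dist (fst (s n)) x < \<delta> \<Longrightarrow> dist (snd (s m)) (snd (s n)) < 1 / Suc k"
    using assms(1) unfolding graph_hull_def graph_osc_def by force
  define e where "e = min \<delta> (dist y y' / 3)"
  have "e > 0"
    using \<open>\<delta> > 0\<close> \<open>y \<noteq> y'\<close> by (simp add: e_def)
  have "(x, y) \<in> closure (range s)" "(x, y') \<in> closure (range s)"
    using assms by (simp_all add: graph_hull_def)
  with \<open>e > 0\<close> obtain m n where m: "dist (s m) (x, y) < e" and n: "dist (s n) (x, y') < e"
    unfolding closure_approachable by blast
  have "dist (snd (s m)) (snd (s n)) < 1 / Suc k"
    using \<delta> m n dist_fst_le[of "s m" "(x, y)"] dist_fst_le[of "s n" "(x, y')"] by (simp add: e_def)
  moreover have "dist (snd (s m)) y < dist y y' / 3" "dist (snd (s n)) y' < dist y y' / 3"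
    using m n dist_snd_le[of "s m" "(x, y)"] dist_snd_le[of "s n" "(x, y')"] by (simp_all add: e_def)
  ultimately show False
    using k dist_triangle[of y y' "snd (s m)"] dist_triangle[of "snd (s m)" y' "snd (s n)"]
      dist_commute[of y "snd (s m)"]
    by linarith
qed

definition graph_on :: "'a set \<Rightarrow> ('a \<Rightarrow> 'b) \<Rightarrow> ('a \<times> 'b) set" where
  "graph_on A f = (\<lambda>x. (x, f x)) ` A"

lemma graph_on_subset_osc:
  assumes f: "continuous_on A f" and s: "range s \<subseteq> graph_on A f"
  shows "graph_on A f \<subseteq> graph_osc s k"
proof
  fix z
  assume "z \<in> graph_on A f"
  then obtain x where x: "x \<in> A" "z = (x, f x)"
    by (auto simp: graph_on_def)
  have "1 / (2 * real (Suc k)) > 0"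
    by simp
  then obtain d where "d > 0" and d: "\<And>x'. x' \<in> A \<Longrightarrow> dist x' x < d \<Longrightarrow> dist (f x') (f x) < 1 / (2 * real (Suc k))"
    using f x(1) unfolding continuous_on_iff by meson
  have s': "fst (s m) \<in> A \<and> snd (s m) = f (fst (s m))" for m
  proof -
    have "s m \<in> graph_on A f"
      using s by blast
    then show ?thesis
      by (auto simp: graph_on_def)
  qed
  have "dist (snd (s m)) (snd (s n)) < 1 / Suc k"
    if "dist (fst (s m)) x < d" "dist (fst (s n)) x < d" for m n
  proof -
    have "dist (snd (s m)) (f x) < 1 / (2 * real (Suc k))" "dist (snd (s n)) (f x) < 1 / (2 * real (Suc k))"
      using d s' that by auto
    then have "dist (snd (s m)) (snd (s n)) < 1 / (2 * real (Suc k)) + 1 / (2 * real (Suc k))"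
      using dist_triangle2[of "snd (s m)" "snd (s n)" "f x"] by linarith
    then show ?thesis
      by (simp add: field_simps)
  qed
  then show "z \<in> graph_osc s k"
    unfolding graph_osc_def x using \<open>d > 0\<close> by auto
qed

text \<open>Together with single-valuedness, this forces a point of the hull lying over
  \<open>A\<close> onto the graph of \<open>f\<close>.\<close>

lemma graph_on_subset_hull:
  assumes "continuous_on A f" "range s \<subseteq> graph_on A f" "graph_on A f \<subseteq> closure (range s)"
  shows "graph_on A f \<subseteq> graph_hull s"
  using assms graph_on_subset_osc[OF assms(1,2)] unfolding graph_hull_def by blast

section \<open>Points of \<open>E X\<close>, their norms, and the number of codes for graphs\<close>

text \<open>By density of \<open>X\<close>, coordinate \<open>j\<close> alone can be moved inside
  \<open>X\<close> to miss \<open>c\<close>; the distance moved is the change in that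
  coordinate.\<close>

lemma E_perturb_coord:
  assumes "closure X = UNIV" "x \<in> E X" "d > 0"
  obtains x' where "x' \<in> E X" "dist x' x < d" "coord x' j \<noteq> c" "\<And>k. k \<noteq> j \<Longrightarrow> coord x' k = coord x k"
proof -
  have "infinite {coord x j - d<..<coord x j + d}"
    using \<open>d > 0\<close> by (simp add: infinite_Ioo)
  then have "{coord x j - d<..<coord x j + d} - {c} \<noteq> {}"
    using finite_subset[of _ "{c}"] by blast
  moreover have "open ({coord x j - d<..<coord x j + d} - {c})"
    by (intro open_Diff) auto
  ultimately have "({coord x j - d<..<coord x j + d} - {c}) \<inter> X \<noteq> {}"
    using assms(1) open_Int_closure_eq_empty by blast
  then obtain t where t: "t \<in> X" "\<bar>t - coord x j\<bar> < d" "t \<noteq> c"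
    by force
  define x' where "x' = x + (t - coord x j) *\<^sub>R ell2_unit j"
  have coord: "coord x' k = (if k = j then t else coord x k)" for k
    by (simp add: x'_def coord_unit)
  show ?thesis
  proof
    show "x' \<in> E X"
      using assms(2) t by (simp add: E_def coord)
    show "dist x' x < d"
      using t by (simp add: x'_def dist_norm norm_unit)
  qed (use t coord in auto)
qed

text \<open>The coordinates of \<open>y\<close> are a permutation \<open>p\<close> of those of
  \<open>x\<close>, and a convergent series of squares may be rearranged.\<close>

lemma norm_eq_of_range_coord_eq:
  assumes "inj (coord x)" "inj (coord y)" "range (coord x) = range (coord y)"
  shows "norm x = norm y"
proof -
  have "\<exists>j. coord y i = coord x j" for i
    using assms(3) by (auto simp: set_eq_iff image_iff)
  then obtain p where p: "\<And>i. coord y i = coord x (p i)"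
    by metis
  have "inj p"
    using assms(2) p by (metis injI injD)
  have "surj p"
  proof -
    have "\<exists>i. j = p i" for j
    proof -
      obtain i where "coord x j = coord y i"
        using assms(3) by (auto simp: set_eq_iff image_iff)
      then show ?thesis
        using p assms(1) by (metis injD)
    qed
    then show ?thesis
      by blast
  qed
  have "(\<Sum>i. (coord y i)\<^sup>2) = suminf ((\<lambda>i. (coord x i)\<^sup>2) \<circ> p)"
    by (simp add: p comp_def)
  also have "\<dots> = (\<Sum>i. (coord x i)\<^sup>2)"
    using \<open>surj p\<close> by (intro suminf_reindex summable_coord_sq \<open>inj p\<close>) auto
  finally show ?thesis
    by (simp add: norm_ell2.rep_eq)
qed

text \<open>The pairs \<open>(s, i)\<close> index the tasks of the transfinite recursion, whose
  length must not exceed the continuum.\<close>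

lemma card_graph_codes:
  "|UNIV :: ((nat \<Rightarrow> ell2 \<times> ell2) \<times> nat) set| \<le>o |UNIV :: nat set set|"
proof -
  obtain h :: "real \<Rightarrow> nat set" where "inj h"
    using eqpoll_imp_lepoll[OF eqpoll_sym[OF nat_sets_eqpoll_reals]] by (auto simp: lepoll_def)
  \<comment> \<open>\<open>Inl\<close> records the index. The other elements list the members of the
    codes of all coordinates, with \<open>b\<close> choosing the component of the pair. These tuples
    form a countable type, so \<open>to_nat\<close> turns the set into a set of numbers.\<close>
  define c where "c q = {Inl (snd q)} \<union>
    {Inr (n, b, k, m) | n b k m. m \<in> h (coord (if b then fst (fst q n) else snd (fst q n)) k)}"
    for q :: "(nat \<Rightarrow> ell2 \<times> ell2) \<times> nat"
  have "inj c"
  proof (rule injI)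
    fix q q' :: "(nat \<Rightarrow> ell2 \<times> ell2) \<times> nat"
    assume eq: "c q = c q'"
    have "Inl i \<in> c q \<longleftrightarrow> i = snd q" for i q
      by (auto simp: c_def)
    then have "snd q = snd q'"
      using eq by metis
    moreover have "Inr (n, b, k, m) \<in> c q \<longleftrightarrow> m \<in> h (coord (if b then fst (fst q n) else snd (fst q n)) k)"
      for n b k m q
      by (auto simp: c_def)
    then have "h (coord (if b then fst (fst q n) else snd (fst q n)) k)
        = h (coord (if b then fst (fst q' n) else snd (fst q' n)) k)" for n b k
      using eq by blast
    then have "coord (if b then fst (fst q n) else snd (fst q n)) k
        = coord (if b then fst (fst q' n) else snd (fst q' n)) k" for n b k
      by (rule injD[OF \<open>inj h\<close>])
    from this[of True] this[of False] have "fst q n = fst q' n" for n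
      by (simp add: prod_eq_iff ell2_eqI)
    ultimately show "q = q'"
      by (auto simp: prod_eq_iff)
  qed
  then have "inj (\<lambda>q. to_nat ` c q)"
    by (simp add: inj_def inj_image_eq_iff)
  then show ?thesis
    by (auto simp flip: card_of_ordLeq)
qed

subsection \<open>The set \<open>X\<close>\<close>

text \<open>The premise does not mention \<open>X\<close>, so it can be decided before \<open>X\<close> is built.\<close>

definition diagonalized :: "real set \<Rightarrow> bool" where
  "diagonalized X \<longleftrightarrow> (\<forall>s i.
     (\<forall>A. |A| <o |UNIV :: nat set set| \<longrightarrow> (\<exists>z\<in>graph_hull s.
        coord (snd z) i \<notin> range (coord (fst z)) \<and> range (coord (fst z)) \<inter> A = {} \<and> coord (snd z) i \<notin> A)) \<longrightarrow>
     (\<exists>z\<in>graph_hull s. range (coord (fst z)) \<subseteq> X \<and> coord (snd z) i \<notin> X))"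

lemma diagonalizedD:
  assumes "diagonalized X"
    and "\<And>A. |A| <o |UNIV :: nat set set| \<Longrightarrow> \<exists>z\<in>graph_hull s.
      coord (snd z) i \<notin> range (coord (fst z)) \<and> range (coord (fst z)) \<inter> A = {} \<and> coord (snd z) i \<notin> A"
  shows "\<exists>z\<in>graph_hull s. range (coord (fst z)) \<subseteq> X \<and> coord (snd z) i \<notin> X"
proof -
  have "\<forall>A. |A| <o |UNIV :: nat set set| \<longrightarrow> (\<exists>z\<in>graph_hull s.
      coord (snd z) i \<notin> range (coord (fst z)) \<and> range (coord (fst z)) \<inter> A = {} \<and> coord (snd z) i \<notin> A)"
    using assms(2) by (intro allI impI)
  moreover have "(\<forall>A. |A| <o |UNIV :: nat set set| \<longrightarrow> (\<exists>z\<in>graph_hull s.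
      coord (snd z) i \<notin> range (coord (fst z)) \<and> range (coord (fst z)) \<inter> A = {} \<and> coord (snd z) i \<notin> A)) \<longrightarrow>
      (\<exists>z\<in>graph_hull s. range (coord (fst z)) \<subseteq> X \<and> coord (snd z) i \<notin> X)"
    using assms(1) unfolding diagonalized_def by (elim allE)
  ultimately show ?thesis
    by (rule rev_mp)
qed

text \<open>In the recursion, \<open>C\<close> is the set of coordinates of \<open>x\<close> and
  \<open>y\<close> a forbidden coordinate of its image, for a point of the hull. Starting from the
  rationals gives density and the elements 0 and 1.\<close>

lemma diagonalized_exists:
  obtains X where "\<rat> \<subseteq> X" "diagonalized X"
proof -
  define R where "R q = (\<lambda>z. (range (coord (fst z)), coord (snd z) (snd q))) `
      {z \<in> graph_hull (fst q). coord (snd z) (snd q) \<notin> range (coord (fst z))}"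
    for q :: "(nat \<Rightarrow> ell2 \<times> ell2) \<times> nat"
  have R: "countable C \<and> y \<notin> C" if "(C, y) \<in> R q" for C y q
    using that by (auto simp: R_def)
  obtain X where X: "\<rat> \<subseteq> X"
    and rich: "\<forall>q. (\<forall>A. |A| <o |UNIV :: nat set set| \<longrightarrow> (\<exists>(C, y)\<in>R q. C \<inter> A = {} \<and> y \<notin> A)) \<longrightarrow>
      (\<exists>(C, y)\<in>R q. C \<subseteq> X \<and> y \<notin> X)"
    by (rule bernstein_recursion[where R = R, OF card_graph_codes countable_rat R])
  have "\<exists>z\<in>graph_hull s. range (coord (fst z)) \<subseteq> X \<and> coord (snd z) i \<notin> X"
    if *: "\<forall>A. |A| <o |UNIV :: nat set set| \<longrightarrow> (\<exists>z\<in>graph_hull s.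
        coord (snd z) i \<notin> range (coord (fst z)) \<and> range (coord (fst z)) \<inter> A = {} \<and> coord (snd z) i \<notin> A)"
    for s i
  proof -
    have "\<exists>(C, y)\<in>R (s, i). C \<inter> A = {} \<and> y \<notin> A" if A: "|A| <o |UNIV :: nat set set|" for A
    proof -
      obtain z where "z \<in> graph_hull s" "coord (snd z) i \<notin> range (coord (fst z))"
        "range (coord (fst z)) \<inter> A = {}" "coord (snd z) i \<notin> A"
        using * A by blast
      then show ?thesis
        by (intro bexI[of _ "(range (coord (fst z)), coord (snd z) i)"]) (simp_all add: R_def)
    qed
    then have "\<exists>(C, y)\<in>R (s, i). C \<subseteq> X \<and> y \<notin> X"
      using rich by blast
    then obtain z where "z \<in> graph_hull s" "range (coord (fst z)) \<subseteq> X" "coord (snd z) i \<notin> X"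
      by (auto simp: R_def)
    then show ?thesis
      by blast
  qed
  then have "diagonalized X"
    unfolding diagonalized_def by blast
  with X show ?thesis
    using that by blast
qed

subsection \<open>Autohomeomorphisms of \<open>E X\<close>\<close>

locale E_homeomorphism =
  fixes X :: "real set" and f g :: "ell2 \<Rightarrow> ell2"
  assumes dense: "closure X = UNIV" and homeo: "homeomorphism (E X) (E X) f g"
begin

text \<open>The setting is symmetric, so every result on \<open>f\<close> can be used for
  \<open>g\<close>.\<close>

lemma inverse: "E_homeomorphism X g f"
  by unfold_locales (rule dense, rule homeomorphism_symD[OF homeo])

lemma f_in: "x \<in> E X \<Longrightarrow> f x \<in> E X" and g_f: "x \<in> E X \<Longrightarrow> g (f x) = x"
  and g_in: "x \<in> E X \<Longrightarrow> g x \<in> E X" and f_g: "x \<in> E X \<Longrightarrow> f (g x) = x"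
  and cont: "continuous_on (E X) f"
  using homeo by (auto simp: homeomorphism_def)

lemma perturb:
  assumes "open U" "x \<in> E X" "(x, f x) \<in> U"
  obtains x' where "x' \<in> E X" "(x', f x') \<in> U" "coord x' j \<noteq> c"
    "\<And>k. k \<noteq> j \<Longrightarrow> coord x' k = coord x k"
proof -
  have "continuous_on (E X) (\<lambda>x. (x, f x))"
    by (intro continuous_intros cont)
  then obtain W where W: "open W" "W \<inter> E X = (\<lambda>x. (x, f x)) -` U \<inter> E X"
    using assms(1) continuous_on_open_invariant[of "E X" "\<lambda>x. (x, f x)"] by blast
  then obtain d where "d > 0" "ball x d \<subseteq> W"
    using assms open_contains_ball by blast
  obtain x' where x': "x' \<in> E X" "dist x' x < d" "coord x' j \<noteq> c"
    "\<And>k. k \<noteq> j \<Longrightarrow> coord x' k = coord x k"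
    using E_perturb_coord[OF dense assms(2) \<open>d > 0\<close>] by blast
  then have "x' \<in> W \<inter> E X"
    using \<open>ball x d \<subseteq> W\<close> by (auto simp: dist_commute)
  then have "(x', f x') \<in> U"
    using W by auto
  with x' show ?thesis
    using that by blast
qed

text \<open>This is \<open>perturb\<close> for the inverse on the swapped neighbourhood: now the
  value is moved and the argument follows.\<close>

lemma perturb_image:
  assumes "open U" "x \<in> E X" "(x, f x) \<in> U"
  obtains x' where "x' \<in> E X" "(x', f x') \<in> U" "coord (f x') j \<noteq> c"
    "\<And>k. k \<noteq> j \<Longrightarrow> coord (f x') k = coord (f x) k"
proof -
  interpret inv: E_homeomorphism X g f
    by (rule inverse)
  have "open (prod.swap -` U)"
    using assms(1) by (intro open_vimage continuous_on_swap)
  moreover have "(f x, g (f x)) \<in> prod.swap -` U"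
    using assms by (simp add: g_f)
  ultimately obtain y where "y \<in> E X" "(y, g y) \<in> prod.swap -` U" "coord y j \<noteq> c"
    "\<And>k. k \<noteq> j \<Longrightarrow> coord y k = coord (f x) k"
    using inv.perturb[of "prod.swap -` U" "f x" j c] f_in[OF assms(2)] by blast
  then show ?thesis
    using that[of "g y"] by (simp add: f_g g_in)
qed

text \<open>Otherwise coordinate \<open>i\<close> of the value generically differs from all
  coordinates of the argument, and \<open>diagonalized X\<close> produces a point of
  \<open>E X\<close> whose image leaves \<open>E X\<close>.\<close>

lemma locally_coordinate:
  assumes diag: "diagonalized X"
    and U: "open U" "U \<inter> graph_on (E X) f \<noteq> {}"
  obtains W j where "open W" "W \<subseteq> U" "W \<inter> graph_on (E X) f \<noteq> {}"
    "\<And>z. z \<in> W \<inter> graph_on (E X) f \<Longrightarrow> coord (snd z) i = coord (fst z) j"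
proof (rule ccontr)
  let ?G = "graph_on (E X) f"
  assume "\<not> thesis"
  with that have bad: "\<exists>z\<in>W \<inter> ?G. coord (snd z) i \<noteq> coord (fst z) j"
    if "open W" "W \<subseteq> U" "W \<inter> ?G \<noteq> {}" for W j
    using that by blast
  obtain T where T: "countable T" "T \<subseteq> ?G" "?G \<subseteq> closure T"
    using separable by blast
  then have "T \<noteq> {}"
    using U by auto
  define s where "s = from_nat_into T"
  have s: "range s = T"
    unfolding s_def using T(1) \<open>T \<noteq> {}\<close> by (intro range_from_nat_into)
  have hull: "?G \<subseteq> graph_hull s"
    using T by (intro graph_on_subset_hull cont) (simp_all add: s)
  \<comment> \<open>Even indices push the limit points into the hull; odd ones keep the
    \<open>i\<close>-th coordinate of the value away from each coordinate of the argument.\<close>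
  define V where "V n = (if even n then graph_osc s (n div 2)
     else {z. coord (snd z) i \<noteq> coord (fst z) (n div 2)})" for n
  \<comment> \<open>All reals that a limit point commits to: index 0 is the one to be kept out of
    \<open>X\<close>, the others are to be put in.\<close>
  define h where "h k z = (case k of 0 \<Rightarrow> coord (snd z) i | Suc j \<Rightarrow> coord (fst z) j)"
    for k and z :: "ell2 \<times> ell2"
  have "\<exists>\<phi> :: nat set \<Rightarrow> ell2 \<times> ell2. (\<forall>a. \<phi> a \<in> closure (?G \<inter> U)) \<and> (\<forall>a n. \<phi> a \<in> V n) \<and>
      (\<forall>k c. finite {a. h k (\<phi> a) = c})"
  proof (rule cantor_scheme[of "?G \<inter> U" V h])
    show "?G \<inter> U \<noteq> {}"
      using U by blast
    show "open (V n)" for n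
      unfolding V_def
      by (auto intro!: open_graph_osc open_Collect_neq continuous_on_coord continuous_intros)
    show "continuous_on UNIV (h k)" for k
      unfolding h_def by (cases k) (auto intro!: continuous_on_coord continuous_intros)
  next
    fix n W
    assume W: "open W" "W \<inter> (?G \<inter> U) \<noteq> {}"
    show "W \<inter> V n \<inter> (?G \<inter> U) \<noteq> {}"
    proof (cases "even n")
      case True
      then have "?G \<subseteq> V n"
        using hull by (auto simp: V_def graph_hull_def)
      then show ?thesis
        using W by blast
    next
      case False
      have "\<exists>z\<in>(W \<inter> U) \<inter> ?G. coord (snd z) i \<noteq> coord (fst z) (n div 2)"
        by (rule bad) (use W U in auto)
      then show ?thesis
        using False by (auto simp: V_def)
    qed
  next
    fix k c W
    assume W: "open W" "W \<inter> (?G \<inter> U) \<noteq> {}"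
    then obtain x where x: "x \<in> E X" "(x, f x) \<in> W \<inter> U"
      by (auto simp: graph_on_def)
    have "open (W \<inter> U)"
      using W U by blast
    show "\<exists>z\<in>W \<inter> (?G \<inter> U). h k z \<noteq> c"
    proof (cases k)
      case 0
      obtain x' where "x' \<in> E X" "(x', f x') \<in> W \<inter> U" "coord (f x') i \<noteq> c"
        using perturb_image[OF \<open>open (W \<inter> U)\<close> x] by blast
      then show ?thesis
        by (intro bexI[of _ "(x', f x')"]) (auto simp: h_def 0 graph_on_def)
    next
      case (Suc j)
      obtain x' where "x' \<in> E X" "(x', f x') \<in> W \<inter> U" "coord x' j \<noteq> c"
        using perturb[OF \<open>open (W \<inter> U)\<close> x] by blast
      then show ?thesis
        by (intro bexI[of _ "(x', f x')"]) (auto simp: h_def Suc graph_on_def)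
    qed
  qed blast
  then obtain \<phi> :: "nat set \<Rightarrow> ell2 \<times> ell2" where \<phi>: "\<And>a. \<phi> a \<in> closure (?G \<inter> U)"
    "\<And>a n. \<phi> a \<in> V n" "\<And>k c. finite {a. h k (\<phi> a) = c}"
    by blast
  have \<phi>_hull: "\<phi> a \<in> graph_hull s" for a
  proof -
    have "closure (?G \<inter> U) \<subseteq> closure (range s)"
      using T s by (intro closure_minimal) auto
    moreover have "\<phi> a \<in> graph_osc s k" for k
      using \<phi>(2)[of a "2 * k"] by (simp add: V_def)
    ultimately show ?thesis
      using \<phi>(1)[of a] by (auto simp: graph_hull_def)
  qed
  have \<phi>_notin: "coord (snd (\<phi> a)) i \<notin> range (coord (fst (\<phi> a)))" for a
  proof -
    have "coord (snd (\<phi> a)) i \<noteq> coord (fst (\<phi> a)) j" for j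
      using \<phi>(2)[of a "2 * j + 1"] by (simp add: V_def)
    then show ?thesis
      by blast
  qed
  have "\<exists>z\<in>graph_hull s. coord (snd z) i \<notin> range (coord (fst z)) \<and> range (coord (fst z)) \<inter> A = {} \<and>
      coord (snd z) i \<notin> A" if A: "|A| <o |UNIV :: nat set set|" for A
  proof -
    \<comment> \<open>The branches whose limit point involves the real \<open>y\<close>. Over
      \<open>y \<in> A\<close> these countable sets leave out some branch \<open>a\<close>, whose
      point avoids \<open>A\<close> altogether.\<close>
    define B where "B y = (\<Union>k. {a. h k (\<phi> a) = y})" for y
    have "countable (B y)" for y
      unfolding B_def by (simp add: countable_finite \<phi>(3))
    then have "|\<Union>y\<in>A. B y| <o |UNIV :: nat set set|"
      by (intro card_UNION_countable_less A)
    then have "(\<Union>y\<in>A. B y) \<noteq> UNIV"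
      using ordLess_irreflexive by metis
    then obtain a where a: "\<And>y k. y \<in> A \<Longrightarrow> h k (\<phi> a) \<noteq> y"
      unfolding B_def by blast
    have "coord (snd (\<phi> a)) i \<notin> A"
      using a[of _ 0] by (auto simp: h_def)
    moreover have "coord (fst (\<phi> a)) j \<notin> A" for j
      using a[of _ "Suc j"] by (auto simp: h_def)
    ultimately show ?thesis
      using \<phi>_hull[of a] \<phi>_notin[of a] by (intro bexI[of _ "\<phi> a"]) auto
  qed
  \<comment> \<open>The argument of \<open>z\<close> lies in \<open>E X\<close>, so its value must
    be the one given by \<open>f\<close>, yet a coordinate of it is outside
    \<open>X\<close>.\<close>
  from diagonalizedD[OF diag this] obtain z
    where z: "z \<in> graph_hull s" "range (coord (fst z)) \<subseteq> X" "coord (snd z) i \<notin> X"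
    by blast
  then have "fst z \<in> E X"
    by (auto simp: E_def)
  then have "(fst z, f (fst z)) \<in> graph_hull s"
    using hull by (auto simp: graph_on_def)
  then have "snd z = f (fst z)"
    using z(1) graph_hull_single_valued[of "fst z" "snd z" s] by simp
  with f_in[OF \<open>fst z \<in> E X\<close>] z(3) show False
    by (simp add: E_def)
qed

text \<open>Baire category inside the set \<open>U\<close> where the norms differ: the generic limit
  point has equal norms after all.\<close>

lemma norm_preserving:
  assumes diag: "diagonalized X"
    and "x \<in> E X"
  shows "norm (f x) = norm x"
proof (rule ccontr)
  assume neq: "norm (f x) \<noteq> norm x"
  interpret inv: E_homeomorphism X g f
    by (rule inverse)
  let ?G = "graph_on (E X) f"
  have swap_G: "prod.swap z \<in> graph_on (E X) g \<longleftrightarrow> z \<in> ?G" for z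
    by (cases z) (auto simp: graph_on_def g_f f_g f_in g_in)
  define U where "U = {z :: ell2 \<times> ell2. norm (snd z) \<noteq> norm (fst z)}"
  have "open U"
    unfolding U_def by (intro open_Collect_neq continuous_intros)
  \<comment> \<open>Density of \<open>P i\<close> near the graph comes from
    \<open>locally_coordinate\<close> for \<open>f\<close>, that of \<open>Q j\<close> from the same
    lemma for \<open>g\<close>.\<close>
  define P where "P i = \<Union>{W. open W \<and> (\<exists>j. \<forall>z\<in>W \<inter> ?G. coord (snd z) i = coord (fst z) j)}" for i
  define Q where "Q j = \<Union>{W. open W \<and> (\<exists>i. \<forall>z\<in>W \<inter> ?G. coord (snd z) i = coord (fst z) j)}" for j
  define D1 where "D1 = (\<lambda>(j, k). {z :: ell2 \<times> ell2. coord (fst z) j \<noteq> coord (fst z) k}) ` {(j, k). j \<noteq> k}"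
  define D2 where "D2 = (\<lambda>(j, k). {z :: ell2 \<times> ell2. coord (snd z) j \<noteq> coord (snd z) k}) ` {(j, k). j \<noteq> k}"
  \<comment> \<open>\<open>U\<close> is included because the limit point is otherwise only known to
    lie in the closure of \<open>?G \<inter> U\<close>.\<close>
  define \<V> where "\<V> = insert U (range P \<union> range Q \<union> D1 \<union> D2)"
  have "countable \<V>"
    by (auto simp: \<V>_def D1_def D2_def)
  have \<V>_open: "open V" if "V \<in> \<V>" for V
    using that \<open>open U\<close> unfolding \<V>_def P_def Q_def D1_def D2_def
    by (auto intro!: open_Collect_neq continuous_on_coord continuous_intros)
  have \<V>_dense: "W \<inter> V \<inter> (?G \<inter> U) \<noteq> {}" if V: "V \<in> \<V>" and W: "open W" "W \<inter> (?G \<inter> U) \<noteq> {}" for V W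
  proof -
    have WU: "open (W \<inter> U)" "(W \<inter> U) \<inter> ?G \<noteq> {}"
      using W \<open>open U\<close> by blast+
    obtain x where x: "x \<in> E X" "(x, f x) \<in> W \<inter> U"
      using W by (auto simp: graph_on_def)
    consider "V = U" | i where "V = P i" | j where "V = Q j"
      | j k where "j \<noteq> k" "V = {z. coord (fst z) j \<noteq> coord (fst z) k}"
      | j k where "j \<noteq> k" "V = {z. coord (snd z) j \<noteq> coord (snd z) k}"
      using V by (auto simp: \<V>_def D1_def D2_def)
    then show ?thesis
    proof cases
      case 1
      then show ?thesis
        using W by blast
    next
      case 2
      obtain O' j where "open O'" "O' \<subseteq> W \<inter> U" "O' \<inter> ?G \<noteq> {}"
        "\<And>z. z \<in> O' \<inter> ?G \<Longrightarrow> coord (snd z) i = coord (fst z) j"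
        using locally_coordinate[OF diag WU, of i] by blast
      moreover from this have "O' \<subseteq> P i"
        unfolding P_def by blast
      ultimately show ?thesis
        unfolding 2 by blast
    next
      case 3
      have "open (prod.swap -` (W \<inter> U))"
        using WU by (intro open_vimage continuous_on_swap)
      moreover have "prod.swap -` (W \<inter> U) \<inter> graph_on (E X) g \<noteq> {}"
      proof -
        have "(f x, x) \<in> prod.swap -` (W \<inter> U) \<inter> graph_on (E X) g"
          using x swap_G[of "(x, f x)"] by (simp add: graph_on_def)
        then show ?thesis
          by blast
      qed
      ultimately obtain O' i where O': "open O'" "O' \<subseteq> prod.swap -` (W \<inter> U)" "O' \<inter> graph_on (E X) g \<noteq> {}"
        "\<And>z. z \<in> O' \<inter> graph_on (E X) g \<Longrightarrow> coord (snd z) j = coord (fst z) i"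
        using inv.locally_coordinate[OF diag, of "prod.swap -` (W \<inter> U)" j] by blast
      have "open (prod.swap -` O')"
        using O' by (intro open_vimage continuous_on_swap)
      moreover have "coord (snd z) i = coord (fst z) j" if "z \<in> prod.swap -` O' \<inter> ?G" for z
        using O'(4)[of "prod.swap z"] that swap_G[of z] by simp
      ultimately have "prod.swap -` O' \<subseteq> Q j"
        unfolding Q_def by blast
      moreover obtain z where "z \<in> O'" "z \<in> graph_on (E X) g"
        using O' by blast
      moreover from this have "prod.swap z \<in> ?G" "prod.swap z \<in> prod.swap -` O'" "prod.swap z \<in> W \<inter> U"
        using swap_G[of "prod.swap z"] O'(2) by auto
      ultimately show ?thesis
        unfolding 3 by blast
    next
      \<comment> \<open>Since \<open>k \<noteq> j\<close>, moving coordinate \<open>j\<close> off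
        the old value of coordinate \<open>k\<close> leaves the latter unchanged.\<close>
      case 4
      obtain x' where "x' \<in> E X" "(x', f x') \<in> W \<inter> U" "coord x' j \<noteq> coord x k"
        "\<And>l. l \<noteq> j \<Longrightarrow> coord x' l = coord x l"
        using perturb[OF WU(1) x] by blast
      then have "(x', f x') \<in> W \<inter> V \<inter> (?G \<inter> U)"
        using 4 by (auto simp: graph_on_def)
      then show ?thesis
        by blast
    next
      case 5
      obtain x' where "x' \<in> E X" "(x', f x') \<in> W \<inter> U" "coord (f x') j \<noteq> coord (f x) k"
        "\<And>l. l \<noteq> j \<Longrightarrow> coord (f x') l = coord (f x) l"
        using perturb_image[OF WU(1) x] by blast
      then have "(x', f x') \<in> W \<inter> V \<inter> (?G \<inter> U)"
        using 5 by (auto simp: graph_on_def)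
      then show ?thesis
        by blast
    qed
  qed
  have rV: "range (from_nat_into \<V>) = \<V>"
    using \<open>countable \<V>\<close> by (intro range_from_nat_into) (auto simp: \<V>_def)
  \<comment> \<open>One branch of the scheme suffices, which is the Baire category argument;
    coordinate 0 of the argument serves as a function that is nowhere locally constant on the
    graph.\<close>
  have "\<exists>z. z \<in> closure (?G \<inter> U) \<and> (\<forall>n. z \<in> from_nat_into \<V> n)"
  proof (rule cantor_scheme[of "?G \<inter> U" "from_nat_into \<V>" "\<lambda>_ z. coord (fst z) 0"])
    show "?G \<inter> U \<noteq> {}"
      using \<open>x \<in> E X\<close> neq by (auto simp: graph_on_def U_def)
    show "open (from_nat_into \<V> n)" for n
      using \<V>_open rV by blast
    show "W \<inter> from_nat_into \<V> n \<inter> (?G \<inter> U) \<noteq> {}" if "open W" "W \<inter> (?G \<inter> U) \<noteq> {}" for n W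
      using \<V>_dense[of "from_nat_into \<V> n"] rV that by blast
    show "continuous_on UNIV (\<lambda>z :: ell2 \<times> ell2. coord (fst z) 0)"
      by (intro continuous_on_coord continuous_intros)
    show "\<exists>z\<in>W \<inter> (?G \<inter> U). coord (fst z) 0 \<noteq> c" if W: "open W" "W \<inter> (?G \<inter> U) \<noteq> {}" for W c
    proof -
      obtain x where x: "x \<in> E X" "(x, f x) \<in> W \<inter> U"
        using W by (auto simp: graph_on_def)
      obtain x' where "x' \<in> E X" "(x', f x') \<in> W \<inter> U" "coord x' 0 \<noteq> c"
        using perturb[OF open_Int[OF W(1) \<open>open U\<close>] x] by blast
      then show ?thesis
        by (intro bexI[of _ "(x', f x')"]) (auto simp: graph_on_def)
    qed
  qed blast
  then obtain z where z: "z \<in> closure (?G \<inter> U)" "\<And>V. V \<in> \<V> \<Longrightarrow> z \<in> V"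
    using rV by blast
  \<comment> \<open>The point \<open>z\<close> may lie off the graph, but an equality of coordinates
    is a closed condition and passes to the closure.\<close>
  have transfer: "coord (snd z) i = coord (fst z) j"
    if W: "open W" "z \<in> W" "\<forall>z\<in>W \<inter> ?G. coord (snd z) i = coord (fst z) j" for W i j
  proof -
    have "closed {z :: ell2 \<times> ell2. coord (snd z) i = coord (fst z) j}"
      by (intro closed_Collect_eq continuous_on_coord continuous_intros)
    moreover have "z \<in> closure (W \<inter> (?G \<inter> U))"
      using open_Int_closure_subset[OF W(1)] z(1) W(2) by blast
    moreover have "W \<inter> (?G \<inter> U) \<subseteq> {z. coord (snd z) i = coord (fst z) j}"
      using W(3) by blast
    ultimately show ?thesis
      using closure_minimal by blast
  qed
  have "\<exists>j. coord (snd z) i = coord (fst z) j" for i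
  proof -
    have "z \<in> P i"
      using z(2) by (simp add: \<V>_def)
    then show ?thesis
      unfolding P_def using transfer by blast
  qed
  moreover have "\<exists>i. coord (snd z) i = coord (fst z) j" for j
  proof -
    have "z \<in> Q j"
      using z(2) by (simp add: \<V>_def)
    then show ?thesis
      unfolding Q_def using transfer by blast
  qed
  ultimately have "range (coord (fst z)) = range (coord (snd z))"
    by (metis (no_types, lifting) image_subset_iff rangeI subset_antisym)
  moreover have "inj (coord (fst z))"
  proof (rule injI, rule ccontr)
    fix j k
    assume jk: "coord (fst z) j = coord (fst z) k" "j \<noteq> k"
    then have "{z. coord (fst z) j \<noteq> coord (fst z) k} \<in> \<V>"
      by (auto simp: \<V>_def D1_def)
    with z(2) jk show False
      by blast
  qed
  moreover have "inj (coord (snd z))"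
  proof (rule injI, rule ccontr)
    fix j k
    assume jk: "coord (snd z) j = coord (snd z) k" "j \<noteq> k"
    then have "{z. coord (snd z) j \<noteq> coord (snd z) k} \<in> \<V>"
      by (auto simp: \<V>_def D2_def)
    with z(2) jk show False
      by blast
  qed
  ultimately have "norm (fst z) = norm (snd z)"
    by (intro norm_eq_of_range_coord_eq)
  moreover have "z \<in> U"
    using z(2) by (simp add: \<V>_def)
  ultimately show False
    by (simp add: U_def)
qed

end

theorem mainTheorem1:
  shows "\<exists>X :: real set. closure X = UNIV \<and> X \<noteq> UNIV \<and>
    (\<forall>f. autohomeomorphism (E X) f \<longrightarrow> (\<forall>x \<in> E X. norm (f x) = norm x)) \<and>
    \<not> homogeneous (E X)"
proof -
  obtain X where X: "\<rat> \<subseteq> X" and diag: "diagonalized X"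
    by (rule diagonalized_exists)
  have dense: "closure X = UNIV"
    using closure_mono[OF X] by (auto simp: Rats_closure_real)
  have norm_pres: "norm (f x) = norm x" if "autohomeomorphism (E X) f" "x \<in> E X" for f x
  proof -
    obtain g where "homeomorphism (E X) (E X) f g"
      using \<open>autohomeomorphism (E X) f\<close> by (auto simp: autohomeomorphism_def)
    then interpret E_homeomorphism X f g
      using dense by unfold_locales
    show ?thesis
      using norm_preserving[OF diag \<open>x \<in> E X\<close>] .
  qed
  \<comment> \<open>For \<open>X = UNIV\<close>, translation by a unit vector would be an
    autohomeomorphism moving 0 to a point of norm 1.\<close>
  have "X \<noteq> UNIV"
  proof
    assume "X = UNIV"
    then have E: "E X = UNIV"
      by (simp add: E_def)
    have "homeomorphism UNIV UNIV ((+) (ell2_unit 0)) (\<lambda>x. x - ell2_unit 0)"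
      by (rule homeomorphismI) (auto intro!: continuous_intros)
    then have "autohomeomorphism (E X) ((+) (ell2_unit 0))"
      unfolding E autohomeomorphism_def by blast
    from norm_pres[OF this, of 0] show False
      by (simp add: E norm_unit)
  qed
  \<comment> \<open>Two points of different norm, 0 and a unit vector, lie in \<open>E X\<close>
    because \<open>X\<close> contains 0 and 1.\<close>
  moreover have "\<not> homogeneous (E X)"
  proof
    assume "homogeneous (E X)"
    moreover have "0 \<in> X" "1 \<in> X"
      using X by auto
    then have "0 \<in> E X" "ell2_unit 0 \<in> E X"
      by (auto simp: E_def coord_unit)
    ultimately obtain f where "autohomeomorphism (E X) f" "f 0 = ell2_unit 0"
      unfolding homogeneous_def by blast
    with norm_pres[OF this(1) \<open>0 \<in> E X\<close>] show False
      by (simp add: norm_unit)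
  qed
  ultimately show ?thesis
    using dense norm_pres by blast
qed

end
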